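(* Let $d\ge 1$ be an integer and let $A,B$ be linearly independent binary forms of order $d$ over $\mathbf{C}$. For $i\ge 0$ put $T_i=(A,B)_i$, and for $0\le r\le \lfloor\frac{d-1}{2}\rfloor$ put $$c_r=\frac{2\binom{d}{2r+1}^2}{\binom{2d-2r}{2r+1}}.$$ Then the Bézoutiant $\mathcal{R}(A,B)$ satisfies $$\mathcal{R}(A,B)=\sum_{r=0}^{\lfloor (d-1)/2\rfloor} c_r\,\omega^{2r}\,(T_{2r+1})^{\mathfrak p}.$$
   Context: All forms are over $\mathbf{C}$. A form of order $e$ is a homogeneous polynomial of degree $e$ in $\mathbf{x}=(x_0,x_1)$; $S_e$ is the space of such forms. Let $\mathbf{y}=(y_0,y_1)$ be a second pair of variables and $\omega=x_0y_1-x_1y_0$. The Bézoutiant of $A,B\in S_d$ is $$\mathcal{R}(A,B)=\frac{A(x_0,x_1)B(y_0,y_1)-B(x_0,x_1)A(y_0,y_1)}{\omega},$$ a polynomial in $\mathbf{x},\mathbf{y}$, homogeneous of degree $d-1$ in each set. Transvectants: for $E\in S_e$, $F\in S_f$ and $0\le r\le\min\{e,f\}$, $$(E,F)_r=\frac{(e-r)!(f-r)!}{e!f!}\sum_{i=0}^r(-1)^i\binom{r}{i}\frac{\partial^rE}{\partial x_0^{r-i}\partial x_1^i}\,\frac{\partial^rF}{\partial x_0^i\partial x_1^{r-i}}\in S_{e+f-2r},$$ and $(E,F)_r=0$ for $r>\min\{e,f\}$. Symmetric polarization: if $E\in S_e$ with $e$ even and $m=e/2$, then $$E^{\mathfrak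 p}=\frac{(e-m)!}{e!}\Big(y_0\frac{\partial}{\partial x_0}+y_1\frac{\partial}{\partial x_1}\Big)^m E,$$ which is homogeneous of degree $e/2$ in $\mathbf{x}$ and in $\mathbf{y}$. *)

theory Defs
  imports Complex_Main "HOL-Library.Poly_Mapping"
begin

text \<open>
  Complex polynomials are finitely supported coefficient functions on monomials, and monomials are
  finitely supported exponent functions on variables. The variables \<open>x\<^sub>0\<close>, \<open>x\<^sub>1\<close>, \<open>y\<^sub>0\<close>, \<open>y\<^sub>1\<close> carry the
  indices 0, 1, 2, 3; no other variable occurs below.
\<close>

type_synonym monomial = "nat \<Rightarrow>\<^sub>0 nat"
type_synonym cpoly = "monomial \<Rightarrow>\<^sub>0 complex"

definition Var :: "nat \<Rightarrow> cpoly" where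
  "Var v = Poly_Mapping.single (Poly_Mapping.single v 1) 1"

definition Const :: "complex \<Rightarrow> cpoly" where
  "Const c = Poly_Mapping.single 0 c"

abbreviation x0 :: cpoly where "x0 \<equiv> Var 0"
abbreviation x1 :: cpoly where "x1 \<equiv> Var 1"
abbreviation y0 :: cpoly where "y0 \<equiv> Var 2"
abbreviation y1 :: cpoly where "y1 \<equiv> Var 3"

definition monom_degree :: "monomial \<Rightarrow> nat" where
  "monom_degree m = (\<Sum>v\<in>Poly_Mapping.keys m. Poly_Mapping.lookup m v)"

definition binary_forms :: "nat \<Rightarrow> cpoly set" where
  "binary_forms e =
     {p. \<forall>m\<in>Poly_Mapping.keys p. Poly_Mapping.keys m \<subseteq> {0, 1} \<and> monom_degree m = e}"

definition lin_indep_pair :: "cpoly \<Rightarrow> cpoly \<Rightarrow> bool" where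
  "lin_indep_pair A B \<longleftrightarrow> (\<forall>a b. Const a * A + Const b * B = 0 \<longrightarrow> a = 0 \<and> b = 0)"

definition subst :: "(nat \<Rightarrow> cpoly) \<Rightarrow> cpoly \<Rightarrow> cpoly" where
  "subst \<sigma> p = (\<Sum>m\<in>Poly_Mapping.keys p. Const (Poly_Mapping.lookup p m) *
     (\<Prod>v\<in>Poly_Mapping.keys m. \<sigma> v ^ Poly_Mapping.lookup m v))"

definition in_y :: "cpoly \<Rightarrow> cpoly" where
  "in_y A = subst (\<lambda>v. if v = 0 then y0 else if v = 1 then y1 else Var v) A"

text \<open>
  The truncated subtraction in the exponent is harmless: it truncates only where the exponent of
  the variable is 0, and then the new coefficient is 0.
\<close>

definition pdiff :: "nat \<Rightarrow> cpoly \<Rightarrow> cpoly" where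
  "pdiff v p = (\<Sum>m\<in>Poly_Mapping.keys p. Poly_Mapping.single (m - Poly_Mapping.single v 1)
     (of_nat (Poly_Mapping.lookup m v) * Poly_Mapping.lookup p m))"

definition omega :: cpoly where
  "omega = x0 * y1 - x1 * y0"

text \<open>
  The quotient by \<open>omega\<close> is unique since the polynomial ring is an integral domain, and it exists
  for \<open>A\<close> and \<open>B\<close> in \<open>binary_forms d\<close> (lemma \<open>bezoutiant_mult_omega\<close>).
\<close>

definition bezoutiant :: "cpoly \<Rightarrow> cpoly \<Rightarrow> cpoly" where
  "bezoutiant A B = (THE R. R * omega = A * in_y B - B * in_y A)"

text \<open>
  The order of a form is passed explicitly to the next two operations, because the zero form has
  every order.
\<close>

definition transvectant :: "nat \<Rightarrow> nat \<Rightarrow> nat \<Rightarrow> cpoly \<Rightarrow> cpoly \<Rightarrow> cpoly" where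
  "transvectant e f r E F =
     (if r \<le> min e f then
        Const (fact (e - r) * fact (f - r) / (fact e * fact f)) *
        (\<Sum>i=0..r. Const ((-1) ^ i * of_nat (r choose i)) *
           (pdiff 0 ^^ (r - i)) ((pdiff 1 ^^ i) E) *
           (pdiff 0 ^^ i) ((pdiff 1 ^^ (r - i)) F))
      else 0)"

text \<open>Only meaningful for even \<open>e\<close>.\<close>

definition polarization :: "nat \<Rightarrow> cpoly \<Rightarrow> cpoly" where
  "polarization e E =
     (let m = e div 2 in
        Const (fact (e - m) / fact e) * ((\<lambda>p. y0 * pdiff 0 p + y1 * pdiff 1 p) ^^ m) E)"

lemma omega_nonzero: "omega \<noteq> 0"
proof
  define m :: monomial where "m = Poly_Mapping.single 0 1 + Poly_Mapping.single 3 1"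
  define n :: monomial where "n = Poly_Mapping.single 1 1 + Poly_Mapping.single 2 1"
  have "Poly_Mapping.lookup m 0 \<noteq> Poly_Mapping.lookup n 0"
    by (simp add: m_def n_def lookup_add lookup_single when_def)
  then have "m \<noteq> n" by auto
  moreover have "omega = Poly_Mapping.single m 1 - Poly_Mapping.single n 1"
    by (simp add: omega_def Var_def mult_single m_def n_def)
  moreover assume "omega = 0"
  ultimately have "Poly_Mapping.lookup (Poly_Mapping.single m 1 - Poly_Mapping.single n (1::complex)) m = 0"
    by simp
  with \<open>m \<noteq> n\<close> show False
    by (simp add: lookup_minus lookup_single when_def)
qed

lemma bezoutiant_eqI:
  assumes "R * omega = A * in_y B - B * in_y A"
  shows "bezoutiant A B = R"
  unfolding bezoutiant_def
proof (rule the_equality, rule assms)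
  fix R' assume "R' * omega = A * in_y B - B * in_y A"
  with assms have "R' * omega = R * omega" by simp
  then show "R' = R" using omega_nonzero by simp
qed

lemma binary_form_expand:
  assumes "A \<in> binary_forms d"
  obtains a where
    "A = (\<Sum>m\<in>Poly_Mapping.keys A. Const (Poly_Mapping.lookup A m) * (x0 ^ a m * x1 ^ (d - a m)))"
    "in_y A = (\<Sum>m\<in>Poly_Mapping.keys A. Const (Poly_Mapping.lookup A m) * (y0 ^ a m * y1 ^ (d - a m)))"
    "\<And>m. m \<in> Poly_Mapping.keys A \<Longrightarrow> a m \<le> d"
proof -
  define a :: "monomial \<Rightarrow> nat" where "a m = Poly_Mapping.lookup m 0" for m
  have Vp: "Var v ^ k = Poly_Mapping.single (Poly_Mapping.single v k) 1" for v k
    by (induction k) (auto simp: Var_def mult_single simp flip: single_add single_one)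
  have sub: "Poly_Mapping.keys m \<subseteq> {0,1}" and deg: "monom_degree m = d"
    if "m \<in> Poly_Mapping.keys A" for m
    using assms that by (auto simp: binary_forms_def)
  have s: "Poly_Mapping.lookup m 0 + Poly_Mapping.lookup m 1 = d"
    if "m \<in> Poly_Mapping.keys A" for m
  proof -
    have "monom_degree m = (\<Sum>v\<in>{0,1}. Poly_Mapping.lookup m v)"
      unfolding monom_degree_def
      by (rule sum.mono_neutral_left) (use sub[OF that] in \<open>auto simp: in_keys_iff\<close>)
    then show ?thesis using deg[OF that] by simp
  qed
  have m: "m = Poly_Mapping.single 0 (a m) + Poly_Mapping.single 1 (d - a m)"
    if "m \<in> Poly_Mapping.keys A" for m
  proof (rule poly_mapping_eqI)
    fix v
    have "Poly_Mapping.lookup m v = 0" if "v \<notin> {0,1}"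
      using sub[OF \<open>m \<in> Poly_Mapping.keys A\<close>] that by (auto simp: in_keys_iff)
    then show "Poly_Mapping.lookup m v =
        Poly_Mapping.lookup (Poly_Mapping.single 0 (a m) + Poly_Mapping.single 1 (d - a m)) v"
      using s[OF that] by (auto simp: lookup_add lookup_single when_def a_def)
  qed
  have "A = (\<Sum>m\<in>Poly_Mapping.keys A. Poly_Mapping.single m (Poly_Mapping.lookup A m))"
    by (rule poly_mapping_eqI)
      (auto simp: lookup_sum lookup_single when_def sum.delta in_keys_iff)
  also have "\<dots> = (\<Sum>m\<in>Poly_Mapping.keys A.
      Const (Poly_Mapping.lookup A m) * (x0 ^ a m * x1 ^ (d - a m)))"
    by (rule sum.cong) (simp_all add: Vp Const_def mult_single del: One_nat_def flip: m)
  finally have 1: "A = \<dots>" .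
  have 2: "in_y A = (\<Sum>m\<in>Poly_Mapping.keys A.
      Const (Poly_Mapping.lookup A m) * (y0 ^ a m * y1 ^ (d - a m)))"
    unfolding in_y_def subst_def
  proof (rule sum.cong)
    fix m assume *: "m \<in> Poly_Mapping.keys A"
    let ?s = "\<lambda>v. if v = 0 then y0 else if v = 1 then y1 else Var v"
    have "(\<Prod>v\<in>Poly_Mapping.keys m. ?s v ^ Poly_Mapping.lookup m v) =
        (\<Prod>v\<in>{0,1}. ?s v ^ Poly_Mapping.lookup m v)"
      by (rule prod.mono_neutral_left) (use sub[OF *] in \<open>auto simp: in_keys_iff\<close>)
    also have "\<dots> = y0 ^ a m * y1 ^ (d - a m)"
      using s[OF *] by (auto simp: a_def)
    finally show "Const (Poly_Mapping.lookup A m) *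
        (\<Prod>v\<in>Poly_Mapping.keys m. ?s v ^ Poly_Mapping.lookup m v) =
        Const (Poly_Mapping.lookup A m) * (y0 ^ a m * y1 ^ (d - a m))" by simp
  qed simp
  have "a m \<le> d" if "m \<in> Poly_Mapping.keys A" for m
    using s[OF that] by (simp add: a_def)
  with 1 2 show ?thesis by (rule that)
qed

lemma bezoutiant_mult_omega:
  assumes "A \<in> binary_forms d" "B \<in> binary_forms d"
  shows "bezoutiant A B * omega = A * in_y B - B * in_y A"
proof -
  let ?X = "\<lambda>i. x0 ^ i * x1 ^ (d - i)" and ?Y = "\<lambda>i. y0 ^ i * y1 ^ (d - i)"
  have D: "omega dvd ?X i * ?Y j - ?X j * ?Y i" if "i \<le> j" "j \<le> d" for i j
  proof -
    define k where "k = j - i"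
    have k: "j = i + k" "d - i = (d - j) + k" using that by (auto simp: k_def)
    have "?X i * ?Y j - ?X j * ?Y i =
        - ((x0 * y0) ^ i * (x1 * y1) ^ (d - j) * ((x0 * y1) ^ k - (x1 * y0) ^ k))"
      unfolding k(2) unfolding k(1) by (simp add: power_add power_mult_distrib algebra_simps)
    moreover have "omega dvd (x0 * y1) ^ k - (x1 * y0) ^ k"
      unfolding omega_def power_diff_sumr2 by simp
    ultimately show ?thesis by simp
  qed
  have D': "omega dvd ?X i * ?Y j - ?X j * ?Y i" if "i \<le> d" "j \<le> d" for i j
  proof (cases "i \<le> j")
    case False
    then have "omega dvd - (?X j * ?Y i - ?X i * ?Y j)"
      using D[of j i] that unfolding dvd_minus_iff by simp
    then show ?thesis by simp
  qed (use D that in auto)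
  obtain a where a:
    "A = (\<Sum>m\<in>Poly_Mapping.keys A. Const (Poly_Mapping.lookup A m) * ?X (a m))"
    "in_y A = (\<Sum>m\<in>Poly_Mapping.keys A. Const (Poly_Mapping.lookup A m) * ?Y (a m))"
    "\<And>m. m \<in> Poly_Mapping.keys A \<Longrightarrow> a m \<le> d"
    by (rule binary_form_expand[OF assms(1)]) (rule that)
  obtain b where b:
    "B = (\<Sum>m\<in>Poly_Mapping.keys B. Const (Poly_Mapping.lookup B m) * ?X (b m))"
    "in_y B = (\<Sum>m\<in>Poly_Mapping.keys B. Const (Poly_Mapping.lookup B m) * ?Y (b m))"
    "\<And>m. m \<in> Poly_Mapping.keys B \<Longrightarrow> b m \<le> d"
    by (rule binary_form_expand[OF assms(2)]) (rule that)
  have gen: "omega dvd (\<Sum>m\<in>M. f m * ?X (a m)) * (\<Sum>n\<in>N. g n * ?Y (b n)) -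
      (\<Sum>n\<in>N. g n * ?X (b n)) * (\<Sum>m\<in>M. f m * ?Y (a m))"
    if "\<And>m. m \<in> M \<Longrightarrow> a m \<le> d" "\<And>n. n \<in> N \<Longrightarrow> b n \<le> d"
    for M N :: "monomial set" and f g :: "monomial \<Rightarrow> cpoly"
  proof -
    have eq: "(\<Sum>m\<in>M. f m * ?X (a m)) * (\<Sum>n\<in>N. g n * ?Y (b n)) -
        (\<Sum>n\<in>N. g n * ?X (b n)) * (\<Sum>m\<in>M. f m * ?Y (a m)) =
        (\<Sum>m\<in>M. \<Sum>n\<in>N. (f m * g n) * (?X (a m) * ?Y (b n) - ?X (b n) * ?Y (a m)))"
      unfolding sum_product sum.swap[of _ N M] sum_subtractf[symmetric]
      by (intro sum.cong refl) (simp add: algebra_simps)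
    show ?thesis
      unfolding eq by (intro dvd_sum dvd_mult D') (use that in auto)
  qed
  have "omega dvd A * in_y B - B * in_y A"
    using gen[of "Poly_Mapping.keys A" "Poly_Mapping.keys B" "\<lambda>m. Const (Poly_Mapping.lookup A m)"
      "\<lambda>n. Const (Poly_Mapping.lookup B n)", OF a(3) b(3)]
    unfolding a(1,2)[symmetric] b(1,2)[symmetric] .
  then obtain R where "R * omega = A * in_y B - B * in_y A"
    by (metis dvdE mult.commute)
  then show ?thesis using bezoutiant_eqI by simp
qed

end

theory Submission
  imports Defs
begin

text \<open>
  Both sides are bilinear in \<open>A\<close> and \<open>B\<close>, and over \<open>\<complex>\<close> the forms of order \<open>d\<close> are spanned by the
  \<open>d\<close>-th powers of the linear forms \<open>x\<^sub>0 + s x\<^sub>1\<close> (lemma \<open>clinear_eq_0_if_powers\<close>). It therefore suffices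
  to treat \<open>A = a\<^sub>x\<^sup>d\<close> and \<open>B = b\<^sub>x\<^sup>d\<close>, where \<open>a\<^sub>x = x\<^sub>0 + s x\<^sub>1\<close> and \<open>b\<^sub>x = x\<^sub>0 + t x\<^sub>1\<close>; write \<open>a\<^sub>y\<close>, \<open>b\<^sub>y\<close>
  for the same forms in \<open>y\<close>.

  For such forms everything is explicit. The transvectant is \<open>(A, B)\<^sub>r = (t - s)\<^sup>r (a\<^sub>x b\<^sub>x)\<^sup>k\<close> with
  \<open>k = d - r\<close>. With \<open>u = a\<^sub>x b\<^sub>y\<close> and \<open>v = b\<^sub>x a\<^sub>y\<close>, the polarization of \<open>(a\<^sub>x b\<^sub>x)\<^sup>k\<close> is \<open>P\<^sub>k(u, v)\<close> divided
  by \<open>2k choose k\<close>, where \<open>P\<^sub>k(u, v) = \<Sum>\<^sub>j (k choose j)\<^sup>2 u\<^sup>j v\<^bsup>k-j\<^esup>\<close>, and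
  \<open>(t - s) \<omega> = u - v\<close>. The numerator of the Bezoutiant is \<open>u\<^sup>d - v\<^sup>d\<close>. So the claim becomes an
  identity in two variables, the odd part of
    \<open>u\<^sup>d = \<Sum>\<^sub>k h\<^sub>d\<^sub>,\<^sub>k (u - v)\<^bsup>d-k\<^esup> P\<^sub>k(u, v)\<close>
  under the exchange of \<open>u\<close> and \<open>v\<close> (lemma \<open>power_diff_eq_sum_legendre\<close>).

  Now \<open>P\<^sub>k(u, v) = (u - v)\<^sup>k L\<^sub>k((u + v) / (u - v))\<close> for the Legendre polynomial \<open>L\<^sub>k\<close>, and the identity
  is the expansion of \<open>((1 + z) / 2)\<^sup>d\<close> in Legendre polynomials. It follows by induction on \<open>d\<close> from the
  three-term recurrence (lemmas \<open>legendre_recurrence\<close> and \<open>legendre_coeff_Suc\<close>).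
\<close>

section \<open>Linear maps, derivations and substitution\<close>

lemma Const_0 [simp]: "Const 0 = 0"
  and Const_1 [simp]: "Const 1 = 1"
  by (simp_all add: Const_def)

lemma Const_add: "Const (a + b) = Const a + Const b"
  by (simp add: Const_def single_add)

lemma Const_mult: "Const (a * b) = Const a * Const b"
  by (simp add: Const_def mult_single)

lemma Const_diff: "Const (a - b) = Const a - Const b"
  by (simp add: Const_def single_diff)

lemma Const_power: "Const (a ^ n) = Const a ^ n"
  by (induction n) (simp_all add: Const_mult)

lemma Const_of_nat: "Const (of_nat n) = of_nat n"
  by (induction n) (simp_all add: Const_add)

lemma Const_sum: "Const (sum f I) = (\<Sum>i\<in>I. Const (f i))"
  by (induction I rule: infinite_finite_induct) (simp_all add: Const_add)

lemma lookup_Const_mult: "Poly_Mapping.lookup (Const a * p) m = a * Poly_Mapping.lookup p m"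
  unfolding Const_def mult_map_scale_conv_mult[symmetric]
  by (simp add: Poly_Mapping.map.rep_eq when_def)

text \<open>Linearity over \<open>\<complex>\<close> means compatibility with multiplication by constant polynomials; this makes the
  closure properties of module homomorphisms available.\<close>

interpretation cpoly: module_pair "\<lambda>a p. Const a * p :: cpoly" "\<lambda>a p. Const a * p :: cpoly"
  by unfold_locales (simp_all add: Const_add Const_mult algebra_simps)

abbreviation clinear :: "(cpoly \<Rightarrow> cpoly) \<Rightarrow> bool" where
  "clinear \<equiv> module_hom (\<lambda>a p. Const a * p) (\<lambda>a p. Const a * p)"

lemma clinearI:
  assumes "\<And>p q. f (p + q) = f p + f q" and "\<And>a p. f (Const a * p) = Const a * f p"
  shows "clinear f"
  by unfold_locales (use assms in auto)

lemma clinear_plus: "clinear f \<Longrightarrow> f (p + q) = f p + f q"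
  by (rule module_hom.add)

lemma clinear_scale: "clinear f \<Longrightarrow> f (Const a * p) = Const a * f p"
  by (rule module_hom.scale)

lemma clinear_mult_left: "clinear f \<Longrightarrow> clinear (\<lambda>p. c * f p)"
  by (rule clinearI) (simp_all only: clinear_plus clinear_scale distrib_left mult.left_commute)

lemma clinear_mult_right: "clinear f \<Longrightarrow> clinear (\<lambda>p. f p * c)"
  using clinear_mult_left[of f c] by (simp add: mult.commute)

lemma clinear_id: "clinear (\<lambda>p. p)"
  by (rule clinearI) simp_all

lemma clinear_compose: "clinear g \<Longrightarrow> clinear f \<Longrightarrow> clinear (\<lambda>p. g (f p))"
  using module_hom_compose[of _ _ f _ g] by (simp add: o_def)

lemma clinear_funpow: "clinear g \<Longrightarrow> clinear (g ^^ n)"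
  by (induction n) (auto intro: clinear_compose clinear_id simp: o_def id_def)

lemma clinear_sum: "(\<And>i. i \<in> I \<Longrightarrow> clinear (f i)) \<Longrightarrow> clinear (\<lambda>p. \<Sum>i\<in>I. f i p)"
  by (rule cpoly.module_hom_sum) (auto simp: cpoly.m1.module_axioms)

lemmas clinear_intros = clinear_mult_left clinear_mult_right clinear_id clinear_sum
  cpoly.module_hom_add cpoly.module_hom_sub

lemma monomials_induct [case_names single add]:
  fixes p :: "'a \<Rightarrow>\<^sub>0 'b :: comm_monoid_add"
  assumes "\<And>m c. P (Poly_Mapping.single m c)" and "\<And>p q. P p \<Longrightarrow> P q \<Longrightarrow> P (p + q)"
  shows "P p"
proof (induction p rule: update_induct)
  case const
  then show ?case using assms(1)[of undefined 0] by simp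
next
  case (update p m c)
  have "Poly_Mapping.update m c p = Poly_Mapping.single m c + p"
    using update by (intro poly_mapping_eqI)
      (auto simp: lookup_update lookup_add lookup_single when_def in_keys_iff)
  then show ?case using assms update by simp
qed

text \<open>The sum over the support that defines \<open>pdiff\<close> changes its index set with \<open>p\<close>, which hides that
  it is additive; the coefficientwise form is visibly linear.\<close>

lemma lookup_pdiff:
  "Poly_Mapping.lookup (pdiff v p) m =
     of_nat (Suc (Poly_Mapping.lookup m v)) * Poly_Mapping.lookup p (m + Poly_Mapping.single v 1)"
proof -
  let ?e = "Poly_Mapping.single v (1::nat)"
  have eq: "n - ?e = m \<longleftrightarrow> n = m + ?e" if "Poly_Mapping.lookup n v \<noteq> 0" for n :: monomial
  proof
    assume "n - ?e = m"
    then show "n = m + ?e"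
      using that by (intro poly_mapping_eqI)
        (auto simp: lookup_add lookup_minus lookup_single when_def)
  qed simp
  have "Poly_Mapping.lookup (pdiff v p) m =
      (\<Sum>n\<in>Poly_Mapping.keys p. if n = m + ?e
         then of_nat (Suc (Poly_Mapping.lookup m v)) * Poly_Mapping.lookup p n else 0)"
    unfolding pdiff_def lookup_sum
  proof (rule sum.cong[OF refl])
    fix n
    show "Poly_Mapping.lookup (Poly_Mapping.single (n - ?e)
        (of_nat (Poly_Mapping.lookup n v) * Poly_Mapping.lookup p n)) m =
        (if n = m + ?e then of_nat (Suc (Poly_Mapping.lookup m v)) * Poly_Mapping.lookup p n else 0)"
    proof (cases "Poly_Mapping.lookup n v = 0")
      case True
      then have "n \<noteq> m + ?e" by (auto simp: lookup_add)
      with True show ?thesis by simp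
    next
      case False
      then show ?thesis using eq[of n] by (auto simp: lookup_single when_def lookup_add)
    qed
  qed
  also have "\<dots> = of_nat (Suc (Poly_Mapping.lookup m v)) * Poly_Mapping.lookup p (m + ?e)"
    by (auto simp: sum.delta in_keys_iff)
  finally show ?thesis .
qed

lemma clinear_pdiff: "clinear (pdiff v)"
  by (rule clinearI; rule poly_mapping_eqI)
    (simp_all add: lookup_pdiff lookup_add lookup_Const_mult distrib_left mult.left_commute
      del: of_nat_Suc)

lemma pdiff_single: "pdiff v (Poly_Mapping.single m c) =
    Poly_Mapping.single (m - Poly_Mapping.single v 1) (of_nat (Poly_Mapping.lookup m v) * c)"
  by (cases "c = 0") (simp_all add: pdiff_def)

definition derivation :: "(cpoly \<Rightarrow> cpoly) \<Rightarrow> bool" where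
  "derivation D \<longleftrightarrow> clinear D \<and> (\<forall>p q. D (p * q) = D p * q + p * D q)"

lemma derivation_pdiff: "derivation (pdiff v)"
proof -
  let ?e = "Poly_Mapping.single v (1::nat)"
  note lin [simp] = module_hom.add[OF clinear_pdiff]
  \<comment> \<open>Where the truncated exponent would spoil this, the coefficient vanishes.\<close>
  have shift: "Poly_Mapping.single (m - ?e + n) (of_nat (Poly_Mapping.lookup m v) * a) =
      Poly_Mapping.single (m + n - ?e) (of_nat (Poly_Mapping.lookup m v) * a)"
    for m n :: monomial and a :: complex
  proof (cases "Poly_Mapping.lookup m v = 0")
    case False
    then have "m - ?e + n = m + n - ?e"
      by (intro poly_mapping_eqI) (auto simp: lookup_add lookup_minus lookup_single when_def)
    then show ?thesis by simp
  qed simp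
  have monomials: "pdiff v (Poly_Mapping.single m a * Poly_Mapping.single n b) =
      pdiff v (Poly_Mapping.single m a) * Poly_Mapping.single n b +
      Poly_Mapping.single m a * pdiff v (Poly_Mapping.single n b)" for m n a b
    using shift[of m n "a * b"] shift[of n m "a * b"]
    by (simp add: mult_single pdiff_single lookup_add ac_simps flip: single_add)
      (simp add: algebra_simps)
  have "pdiff v (p * q) = pdiff v p * q + p * pdiff v q" for p q
  proof (induction p rule: monomials_induct)
    case (single m a)
    show ?case
      by (induction q rule: monomials_induct) (rule monomials, simp add: distrib_left add_ac)
  qed (simp add: distrib_right add_ac)
  then show ?thesis by (simp add: derivation_def clinear_pdiff)
qed

lemma derivation_linear: "derivation D \<Longrightarrow> clinear D"
  and derivation_mult: "derivation D \<Longrightarrow> D (p * q) = D p * q + p * D q"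
  by (simp_all add: derivation_def)

lemma derivation_1: "derivation D \<Longrightarrow> D 1 = 0"
  using derivation_mult[of D 1 1] by simp

lemma derivation_Const: "derivation D \<Longrightarrow> D (Const c) = 0"
  using module_hom.scale[OF derivation_linear, of D c 1] by (simp add: derivation_1)

lemma derivation_combination:
  assumes "derivation D" "derivation E"
  shows "derivation (\<lambda>p. f * D p + g * E p)"
  unfolding derivation_def
  by (auto intro!: clinear_intros assms[THEN derivation_linear]
      simp: assms[THEN derivation_mult] algebra_simps)

lemma derivation_power:
  assumes "derivation D"
  shows "D (p ^ Suc n) = of_nat (Suc n) * p ^ n * D p"
  by (induction n) (simp_all add: derivation_mult[OF assms] algebra_simps)

text \<open>A derivation acts on the powers of an element \<open>p\<close> as \<open>d/dt\<close> on powers of \<open>t\<close> as soon as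
  \<open>D p\<close> is a constant of \<open>D\<close>.\<close>

lemma derivation_funpow_power:
  assumes D: "derivation D" and "D (D p) = 0" and "k \<le> n"
  shows "(D ^^ k) (p ^ n) = Const (fact n / fact (n - k)) * (p ^ (n - k) * D p ^ k)"
  using \<open>k \<le> n\<close>
proof (induction k)
  case (Suc k)
  define l where "l = n - Suc k"
  have l: "n - k = Suc l" using Suc.prems by (simp add: l_def)
  have const: "D (D p ^ k) = 0"
    using derivation_power[OF D, of "D p"] assms(2) by (cases k) (simp_all add: derivation_1[OF D])
  have "(fact n / fact (Suc l) * of_nat (Suc l) :: complex) = fact n / fact l"
    by (simp add: divide_simps del: of_nat_Suc)
  then have coeff: "Const (fact n / fact (Suc l)) * of_nat (Suc l) = Const (fact n / fact l)"
    by (simp only: Const_mult [symmetric] Const_of_nat [symmetric])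
  have "(D ^^ Suc k) (p ^ n) = Const (fact n / fact (Suc l)) * D (p ^ Suc l * D p ^ k)"
    using Suc by (simp add: clinear_scale[OF derivation_linear[OF D]] l del: fact_Suc power_Suc)
  also have "D (p ^ Suc l * D p ^ k) = of_nat (Suc l) * (p ^ l * D p ^ Suc k)"
    by (simp only: derivation_mult[OF D] const derivation_power[OF D]) (simp add: algebra_simps)
  also have "Const (fact n / fact (Suc l)) * \<dots> = Const (fact n / fact l) * (p ^ l * D p ^ Suc k)"
    by (simp only: mult.assoc [symmetric] coeff)
  finally show ?case by (simp only: l_def)
qed simp

lemma derivation_funpow_mult:
  assumes D: "derivation D"
  shows "(D ^^ n) (p * q) =
    (\<Sum>i\<le>n. of_nat (n choose i) * ((D ^^ i) p * (D ^^ (n - i)) q))"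
proof (induction n)
  case (Suc n)
  let ?t = "\<lambda>i j. (D ^^ i) p * (D ^^ j) q"
  have of_nat: "D (of_nat k) = 0" for k
    using derivation_Const[OF D, of "of_nat k"] by (simp add: Const_of_nat)
  have "(D ^^ Suc n) (p * q) =
      (\<Sum>i\<le>n. of_nat (n choose i) * (?t (Suc i) (n - i) + ?t i (Suc n - i)))"
    by (simp add: Suc module_hom.sum[OF derivation_linear[OF D]] of_nat derivation_mult[OF D]
        Suc_diff_le)
  also have "\<dots> = (\<Sum>i\<le>n. of_nat (n choose i) * ?t (Suc i) (n - i)) +
      (\<Sum>i\<le>Suc n. of_nat (n choose i) * ?t i (Suc n - i))"
    by (simp add: distrib_left sum.distrib)
  also have "\<dots> = (\<Sum>i\<le>Suc n. of_nat (Suc n choose i) * ?t i (Suc n - i))"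
    unfolding sum.atMost_Suc_shift
    by (simp add: distrib_right sum.distrib add_ac del: funpow.simps)
  finally show ?case .
qed simp

lemma subst_eq_sum_superset:
  assumes "finite S" "Poly_Mapping.keys p \<subseteq> S"
  shows "subst \<sigma> p = (\<Sum>m\<in>S. Const (Poly_Mapping.lookup p m) *
    (\<Prod>v\<in>Poly_Mapping.keys m. \<sigma> v ^ Poly_Mapping.lookup m v))"
  unfolding subst_def
  by (rule sum.mono_neutral_left) (use assms in \<open>auto simp: in_keys_iff\<close>)

lemma clinear_subst: "clinear (subst \<sigma>)"
proof (rule clinearI)
  fix p q :: cpoly
  let ?S = "Poly_Mapping.keys p \<union> Poly_Mapping.keys q"
  have S: "finite ?S" "Poly_Mapping.keys p \<subseteq> ?S" "Poly_Mapping.keys q \<subseteq> ?S"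
    "Poly_Mapping.keys (p + q) \<subseteq> ?S"
    using keys_add[of p q] by auto
  show "subst \<sigma> (p + q) = subst \<sigma> p + subst \<sigma> q"
    unfolding S(2-4)[THEN subst_eq_sum_superset[OF S(1)]]
    by (simp only: lookup_add Const_add distrib_right sum.distrib)
next
  fix a and p :: cpoly
  have "Poly_Mapping.keys (Const a * p) \<subseteq> Poly_Mapping.keys p"
    by (auto simp: in_keys_iff lookup_Const_mult)
  then have "subst \<sigma> (Const a * p) = (\<Sum>m\<in>Poly_Mapping.keys p.
      Const (Poly_Mapping.lookup (Const a * p) m) *
      (\<Prod>v\<in>Poly_Mapping.keys m. \<sigma> v ^ Poly_Mapping.lookup m v))"
    by (rule subst_eq_sum_superset[OF finite_keys])
  then show "subst \<sigma> (Const a * p) = Const a * subst \<sigma> p"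
    by (simp only: subst_def lookup_Const_mult Const_mult sum_distrib_left mult.assoc)
qed

lemma subst_single: "subst \<sigma> (Poly_Mapping.single m c) =
    Const c * (\<Prod>v\<in>Poly_Mapping.keys m. \<sigma> v ^ Poly_Mapping.lookup m v)"
  by (cases "c = 0") (simp_all add: subst_def)

lemma subst_Var: "subst \<sigma> (Var v) = \<sigma> v"
  by (simp add: Var_def subst_single)

lemma subst_Const: "subst \<sigma> (Const c) = Const c"
  using subst_single[of \<sigma> 0 c] by (simp add: Const_def)

lemma subst_mult: "subst \<sigma> (p * q) = subst \<sigma> p * subst \<sigma> q"
proof -
  note lin [simp] = module_hom.add[OF clinear_subst]
  let ?M = "\<lambda>m. \<Prod>v\<in>Poly_Mapping.keys m. \<sigma> v ^ Poly_Mapping.lookup m v"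
  have M: "?M m = (\<Prod>v\<in>S. \<sigma> v ^ Poly_Mapping.lookup m v)"
    if "finite S" "Poly_Mapping.keys m \<subseteq> S" for m S
    by (rule prod.mono_neutral_left) (use that in \<open>auto simp: in_keys_iff\<close>)
  have M_add: "?M (m + n) = ?M m * ?M n" for m n
  proof -
    let ?S = "Poly_Mapping.keys m \<union> Poly_Mapping.keys n"
    have "?M (m + n) = (\<Prod>v\<in>?S. \<sigma> v ^ Poly_Mapping.lookup (m + n) v)"
      by (rule M) (use keys_add[of m n] in auto)
    also have "\<dots> = (\<Prod>v\<in>?S. \<sigma> v ^ Poly_Mapping.lookup m v) *
        (\<Prod>v\<in>?S. \<sigma> v ^ Poly_Mapping.lookup n v)"
      by (simp only: lookup_add power_add prod.distrib)
    also have "\<dots> = ?M m * ?M n"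
      by (intro arg_cong2[where f = "(*)"] M[symmetric]) auto
    finally show ?thesis .
  qed
  have monomials: "subst \<sigma> (Poly_Mapping.single m a * Poly_Mapping.single n b) =
      subst \<sigma> (Poly_Mapping.single m a) * subst \<sigma> (Poly_Mapping.single n b)" for m n a b
    by (simp only: mult_single subst_single Const_mult M_add mult.assoc mult.left_commute)
  show ?thesis
  proof (induction p rule: monomials_induct)
    case (single m a)
    show ?case
      by (induction q rule: monomials_induct) (simp_all only: monomials lin distrib_left)
  qed (simp only: lin distrib_right)
qed

lemma subst_power: "subst \<sigma> (p ^ n) = subst \<sigma> p ^ n"
  using subst_Const[of \<sigma> 1] by (induction n) (simp_all add: subst_mult)

section \<open>Homogeneous Legendre polynomials\<close>

text \<open>Binary forms given by integer coefficients. Multiplication by a variable shifts the coefficient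
  sequence, so identities between such forms reduce to identities between coefficients.\<close>

definition bihom :: "nat \<Rightarrow> (nat \<Rightarrow> int) \<Rightarrow> 'a :: comm_ring_1 \<Rightarrow> 'a \<Rightarrow> 'a" where
  "bihom n c u v = (\<Sum>j\<le>n. of_int (c j) * (u ^ j * v ^ (n - j)))"

text \<open>The homogenized Legendre polynomial \<open>(u - v)\<^sup>n L\<^sub>n((u + v) / (u - v))\<close>, with the denominator cleared
  so that it makes sense in any commutative ring.\<close>

definition legendre :: "nat \<Rightarrow> 'a :: comm_ring_1 \<Rightarrow> 'a \<Rightarrow> 'a" where
  "legendre n u v = bihom n (\<lambda>j. int (n choose j) ^ 2) u v"

lemma bihom_mult_right:
  assumes "c (Suc n) = 0"
  shows "bihom n c u v * v = bihom (Suc n) c u v"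
  using assms by (simp add: bihom_def sum_distrib_left Suc_diff_le ac_simps)

lemma bihom_mult_left: "bihom n c u v * u = bihom (Suc n) (case_nat 0 c) u v"
  unfolding bihom_def sum.atMost_Suc_shift by (simp add: sum_distrib_left ac_simps)

lemma bihom_add: "bihom n c u v + bihom n c' u v = bihom n (\<lambda>j. c j + c' j) u v"
  by (simp add: bihom_def sum.distrib algebra_simps)

lemma bihom_of_nat_mult: "of_nat k * bihom n c u v = bihom n (\<lambda>j. int k * c j) u v"
  by (simp add: bihom_def sum_distrib_left algebra_simps)

lemma bihom_diff: "bihom n c u v - bihom n c' u v = bihom n (\<lambda>j. c j - c' j) u v"
  by (simp add: bihom_def sum_subtractf algebra_simps)

lemma legendre_0 [simp]: "legendre 0 u v = 1"
  and legendre_1: "legendre 1 u v = u + v"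
  by (simp_all add: legendre_def bihom_def)

lemma legendre_swap: "legendre n u v = legendre n v u"
proof -
  have "legendre n u v = (\<Sum>j\<le>n. of_int (int (n choose (n - j)) ^ 2) * (u ^ (n - j) * v ^ (n - (n - j))))"
    unfolding legendre_def bihom_def using sum.nat_diff_reindex
    [of "\<lambda>j. of_int (int (n choose j) ^ 2) * (u ^ j * v ^ (n - j))" "Suc n"]
    by (simp add: lessThan_Suc_atMost)
  also have "\<dots> = legendre n v u"
    unfolding legendre_def bihom_def
    by (rule sum.cong) (simp_all add: binomial_symmetric [symmetric] mult.commute)
  finally show ?thesis .
qed

lemma binomial_Suc_right_mult:
  "int (n choose Suc k) * int (Suc k) = int (n choose k) * (int n - int k)"
proof (cases "k \<le> n")
  case True
  have "(n choose Suc k) * Suc k = (n choose k) * (n - k)"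
    using binomial_absorption[of k n] binomial_absorb_comp[of n k] by (simp only: mult.commute)
  then show ?thesis
    using True by (metis of_nat_diff of_nat_mult)
qed (simp add: binomial_eq_0)

text \<open>This is the homogenized Bonnet recurrence
  \<open>(m + 1) L\<^bsub>m+1\<^esub>(z) + m L\<^bsub>m-1\<^esub>(z) = (2 m + 1) z L\<^sub>m(z)\<close> at \<open>m = n + 1\<close>. Comparing coefficients, it
  is a quadratic relation between three neighbouring binomial coefficients \<open>a\<close>, \<open>b\<close>, \<open>c\<close> of one row,
  and it follows from the two linear relations between neighbours.\<close>

lemma legendre_recurrence:
  "of_nat (n + 2) * legendre (n + 2) u v + of_nat (n + 1) * ((u - v) ^ 2 * legendre n u v) =
   of_nat (2 * n + 3) * ((u + v) * legendre (n + 1) u v)"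
proof -
  let ?b = "\<lambda>n j. int (n choose j) ^ 2"
  let ?s = "case_nat (0::int)"
  have coeff: "int (n + 2) * ?b (n + 2) j +
      int (n + 1) * (?s (?s (?b n)) j - 2 * ?s (?b n) j + ?b n j) =
      int (2 * n + 3) * (?s (?b (n + 1)) j + ?b (n + 1) j)" for j
  proof -
    consider "j = 0" | "j = 1" | i where "j = i + 2"
      by (metis One_nat_def Suc_1 add.commute add_Suc_shift not0_implies_Suc plus_1_eq_Suc)
    then show ?thesis
    proof cases
      case 3
      define a b c where "a = int (n choose i)" and "b = int (n choose (i + 1))"
        and "c = int (n choose (i + 2))"
      define N I where "N = int n" and "I = int i"
      have ab: "a * (N - I) - b * (I + 1) = 0"
        using binomial_Suc_right_mult[of n i] by (simp add: N_def I_def a_def b_def algebra_simps)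
      have bc: "c * (I + 2) - b * (N - I - 1) = 0"
        using binomial_Suc_right_mult[of n "i + 1"]
        by (simp add: N_def I_def b_def c_def algebra_simps)
      \<comment> \<open>The multipliers \<open>a + b\<close> and \<open>b + c\<close> eliminate \<open>I\<close>, which does not occur on the left.\<close>
      have "(N + 2) * (a + 2 * b + c) ^ 2 + (N + 1) * (a ^ 2 - 2 * b ^ 2 + c ^ 2) -
          (2 * N + 3) * ((a + b) ^ 2 + (b + c) ^ 2) =
          2 * ((a + b) * (c * (I + 2) - b * (N - I - 1)) + (b + c) * (a * (N - I) - b * (I + 1)))"
        by (simp add: power2_eq_square algebra_simps)
      then have quadratic: "(N + 2) * (a + 2 * b + c) ^ 2 + (N + 1) * (a ^ 2 - 2 * b ^ 2 + c ^ 2) =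
          (2 * N + 3) * ((a + b) ^ 2 + (b + c) ^ 2)"
        unfolding ab bc by simp
      have pascal: "int ((n + 1) choose (i + 1)) = a + b" "int ((n + 1) choose (i + 2)) = b + c"
        "int ((n + 2) choose (i + 2)) = a + 2 * b + c"
        by (simp_all add: a_def b_def c_def numeral_2_eq_2)
      have s: "?s f (i + 2) = f (i + 1)" "?s f (i + 1) = f i" for f
        by (simp_all add: numeral_2_eq_2)
      have "int (n + 2) = N + 2" "int (n + 1) = N + 1" "int (2 * n + 3) = 2 * N + 3"
        by (simp_all add: N_def)
      with quadratic show ?thesis
        unfolding 3 s pascal a_def [symmetric] b_def [symmetric] c_def [symmetric]
        by (simp only: right_diff_distrib distrib_left)
    qed (auto simp: power2_eq_square algebra_simps)
  qed
  have left: "legendre m u v * u = bihom (Suc m) (?s (?b m)) u v" for m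
    unfolding legendre_def by (rule bihom_mult_left)
  have right: "legendre m u v * v = bihom (Suc m) (?b m) u v" for m
    unfolding legendre_def by (rule bihom_mult_right) simp
  have L1: "(u + v) * legendre (n + 1) u v = bihom (n + 2) (\<lambda>j. ?s (?b (n + 1)) j + ?b (n + 1) j) u v"
  proof -
    have "(u + v) * legendre (n + 1) u v = legendre (n + 1) u v * u + legendre (n + 1) u v * v"
      by (simp add: algebra_simps)
    then show ?thesis unfolding left right bihom_add by simp
  qed
  have L2: "(u - v) ^ 2 * legendre n u v =
      bihom (n + 2) (\<lambda>j. ?s (?s (?b n)) j - 2 * ?s (?b n) j + ?b n j) u v"
  proof -
    have "(u - v) ^ 2 * legendre n u v = legendre n u v * u * u - of_nat 2 * (legendre n u v * u * v)
        + legendre n u v * v * v"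
      by (simp add: power2_eq_square algebra_simps)
    also have "legendre n u v * u * u = bihom (n + 2) (?s (?s (?b n))) u v"
      unfolding left bihom_mult_left by simp
    also have "legendre n u v * u * v = bihom (n + 2) (?s (?b n)) u v"
      unfolding left by (subst bihom_mult_right) simp_all
    also have "legendre n u v * v * v = bihom (n + 2) (?b n) u v"
      unfolding right by (subst bihom_mult_right) simp_all
    finally show ?thesis by (simp only: bihom_of_nat_mult bihom_diff bihom_add) simp
  qed
  show ?thesis
    unfolding L1 L2 unfolding legendre_def bihom_of_nat_mult bihom_add
    using coeff by simp
qed

text \<open>The coefficient of \<open>L\<^sub>k\<close> in the Legendre expansion of \<open>((1 + z) / 2)\<^sup>n\<close>. The value 0 for \<open>k > n\<close> lets the
  recurrence below hold for all \<open>k\<close>, and lets the summation ranges be extended freely.\<close>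

definition legendre_coeff :: "nat \<Rightarrow> nat \<Rightarrow> complex" where
  "legendre_coeff n k =
     (if k \<le> n then fact n ^ 2 * of_nat (2 * k + 1) / (fact (n - k) * fact (n + k + 1)) else 0)"

text \<open>With \<open>k = n - r\<close> this is the shape in which the coefficients occur in the expansion of the
  Bezoutiant: the last factor of the denominator comes from the normalization of the polarization.\<close>

lemma legendre_coeff_eq_binomials:
  assumes "k \<le> n"
  shows "legendre_coeff n k = of_nat (n choose k) ^ 2 /
    (of_nat ((n + k + 1) choose (n - k)) * of_nat ((2 * k) choose k))"
proof -
  have eqs: "n + k + 1 - (n - k) = Suc (2 * k)" "2 * k - k = k" using assms by simp_all
  have f: "fact (Suc (2 * k)) = (of_nat (2 * k + 1) * fact (2 * k) :: complex)"
    by (simp only: fact_Suc) simp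
  have b1: "of_nat (n choose k) = (fact n / (fact k * fact (n - k)) :: complex)"
    by (rule binomial_fact[OF assms])
  have b2: "of_nat ((n + k + 1) choose (n - k)) =
      (fact (n + k + 1) / (fact (n - k) * (of_nat (2 * k + 1) * fact (2 * k))) :: complex)"
    using binomial_fact[of "n - k" "n + k + 1", where 'a = complex] unfolding eqs f by simp
  have b3: "of_nat ((2 * k) choose k) = (fact (2 * k) / (fact k * fact k) :: complex)"
    using binomial_fact[of k "2 * k", where 'a = complex] unfolding eqs by simp
  show ?thesis
    using assms unfolding legendre_coeff_def b1 b2 b3
    by (simp add: field_simps power2_eq_square del: fact_Suc of_nat_add of_nat_mult of_nat_Suc)
qed

text \<open>Multiplication by \<open>2 u\<close> sends \<open>P\<^sub>j\<close> to a combination of \<open>P\<^bsub>j+1\<^esub>\<close>, \<open>P\<^bsub>j-1\<^esub>\<close> and \<open>P\<^sub>j\<close>, see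
  \<open>legendre_mult_left\<close>; the three terms collect what arrives at index \<open>k\<close> from below, from above and
  from \<open>k\<close> itself. After extracting the common factor \<open>F\<close> a polynomial identity in \<open>n\<close> and \<open>k\<close>
  remains.\<close>

lemma legendre_coeff_Suc:
  "2 * legendre_coeff (Suc n) k =
     (case k of 0 \<Rightarrow> 0 | Suc j \<Rightarrow> of_nat k / of_nat (2 * j + 1) * legendre_coeff n j) +
     of_nat (k + 1) / of_nat (2 * k + 3) * legendre_coeff n (Suc k) + legendre_coeff n k"
proof -
  have polynomial_identity: "2 * (x * ((p + 1) ^ 2 * (2 * q + 1))) =
      x * (q * (p + q + 1) * (p + q + 2)) + x * ((q + 1) * (p - q) * (p - q + 1)) +
      x * ((2 * q + 1) * (p + 1 - q) * (p + q + 2))" for p q x :: complex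
    by (simp add: power2_eq_square algebra_simps)
  define F :: complex where "F = fact n ^ 2 / (fact (Suc n - k) * fact (n + k + 2))"
  have fs: "fact (n + k + 2) = (of_nat n + of_nat k + 2) * (fact (n + k + 1) :: complex)"
    "fact (n + k + 1) = (of_nat n + of_nat k + 1) * (fact (n + k) :: complex)"
    by (simp_all add: algebra_simps)
  have nz: "(of_nat n + of_nat k + 2 :: complex) \<noteq> 0" "(of_nat n + of_nat k + 1 :: complex) \<noteq> 0"
    by (metis of_nat_add of_nat_numeral of_nat_eq_0_iff add_is_0 zero_neq_numeral)
      (metis of_nat_add of_nat_1 of_nat_eq_0_iff add_is_0 zero_neq_one)
  have nzk: "of_nat (2 * j + 1) \<noteq> (0 :: complex)" "of_nat (2 * j + 3) \<noteq> (0 :: complex)" for j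
    by (simp_all only: of_nat_eq_0_iff)
  \<comment> \<open>The factorials of truncated differences obey their recurrence only for \<open>k \<le> n\<close>; at \<open>k = Suc n\<close> only
    the contribution from below survives.\<close>
  consider "k > Suc n" | "k = Suc n" | "k \<le> n" by linarith
  then show ?thesis
  proof cases
    case 1
    then show ?thesis by (auto simp: legendre_coeff_def split: nat.split)
  next
    case 2
    have K: "of_nat k = (of_nat n + 1 :: complex)" using 2 by simp
    have "legendre_coeff (Suc n) k = F * (of_nat n + 1) ^ 2 * (2 * of_nat k + 1)"
      using 2 by (simp add: legendre_coeff_def F_def power2_eq_square algebra_simps)
    moreover have "legendre_coeff n n = of_nat (2 * n + 1) *
        (F * (of_nat n + of_nat k + 1) * (of_nat n + of_nat k + 2))"
      using 2 fs nz by (simp add: legendre_coeff_def F_def del: fact_Suc)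
    then have "of_nat k / of_nat (2 * n + 1) * legendre_coeff n n =
        of_nat k * (F * (of_nat n + of_nat k + 1) * (of_nat n + of_nat k + 2))"
      using nzk(1)[of n] by (simp del: of_nat_Suc of_nat_add of_nat_mult)
    moreover have "legendre_coeff n (Suc k) = 0" "legendre_coeff n k = 0"
      using 2 by (simp_all add: legendre_coeff_def)
    moreover have "2 * (F * (of_nat n + 1) ^ 2 * (2 * of_nat k + 1)) =
        of_nat k * (F * (of_nat n + of_nat k + 1) * (of_nat n + of_nat k + 2))"
      unfolding K by algebra
    ultimately show ?thesis
      using 2 by simp
  next
    case 3
    define c where "c = (of_nat n - of_nat k + 1 :: complex)"
    have g: "fact (Suc n - k) = c * fact (n - k)"
      using 3 by (simp add: c_def Suc_diff_le of_nat_diff algebra_simps)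
    have cnz: "c \<noteq> 0"
      using 3 by (simp add: c_def flip: of_nat_diff) (metis of_nat_Suc of_nat_neq_0 add.commute)
    have A: "legendre_coeff (Suc n) k = F * ((of_nat n + 1) ^ 2 * (2 * of_nat k + 1))"
      using 3 by (simp add: legendre_coeff_def F_def power2_eq_square algebra_simps)
    have B: "(case k of 0 \<Rightarrow> 0 | Suc j \<Rightarrow> of_nat k / of_nat (2 * j + 1) * legendre_coeff n j) =
        F * (of_nat k * (of_nat n + of_nat k + 1) * (of_nat n + of_nat k + 2))"
    proof (cases k)
      case (Suc j)
      have "legendre_coeff n j = of_nat (2 * j + 1) * (fact n ^ 2 / (fact (Suc n - k) * fact (n + k)))"
        using 3 Suc by (simp add: legendre_coeff_def)
      also have "fact n ^ 2 / (fact (Suc n - k) * fact (n + k)) =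
          F * (of_nat n + of_nat k + 1) * (of_nat n + of_nat k + 2)"
        unfolding F_def fs using nz by simp
      finally show ?thesis
        using Suc nzk(1)[of j] by (simp del: of_nat_Suc of_nat_add of_nat_mult)
    qed simp
    have C: "of_nat (k + 1) / of_nat (2 * k + 3) * legendre_coeff n (Suc k) =
        F * ((of_nat k + 1) * (of_nat n - of_nat k) * (of_nat n - of_nat k + 1))"
    proof (cases "k = n")
      case False
      have g': "fact (n - k) = (of_nat n - of_nat k) * (fact (n - Suc k) :: complex)"
        using 3 False fact_Suc[of "n - Suc k", where ?'a = complex]
        by (simp add: Suc_diff_Suc of_nat_diff)
      have nz': "(of_nat n - of_nat k :: complex) \<noteq> 0" using False by simp
      have "legendre_coeff n (Suc k) =
          of_nat (2 * k + 3) * (fact n ^ 2 / (fact (n - Suc k) * fact (n + k + 2)))"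
        using 3 False by (simp add: legendre_coeff_def del: fact_Suc)
      also have "fact n ^ 2 / (fact (n - Suc k) * fact (n + k + 2)) = F * (of_nat n - of_nat k) * c"
        using nz' cnz by (simp add: F_def g g' del: fact_Suc)
      finally show ?thesis
        using nzk(2)[of k] by (simp add: c_def del: of_nat_mult)
    qed (simp add: legendre_coeff_def)
    have D: "legendre_coeff n k = F * ((2 * of_nat k + 1) * (of_nat n + 1 - of_nat k) *
        (of_nat n + of_nat k + 2))"
    proof -
      have "legendre_coeff n k = (2 * of_nat k + 1) * (fact n ^ 2 / (fact (n - k) * fact (n + k + 1)))"
        using 3 by (simp add: legendre_coeff_def del: fact_Suc)
      also have "fact n ^ 2 / (fact (n - k) * fact (n + k + 1)) = F * c * (of_nat n + of_nat k + 2)"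
        unfolding F_def fs(1) g using nz cnz by (simp del: fact_Suc)
      finally show ?thesis by (simp add: c_def algebra_simps)
    qed
    show ?thesis unfolding A B C D by (rule polynomial_identity)
  qed
qed

lemma Const_cancel:
  assumes "c \<noteq> 0" and "Const c * p = Const c * q"
  shows "p = q"
proof -
  have "Const (1 / c) * Const c = 1"
    using assms(1) by (simp flip: Const_mult)
  then show ?thesis using assms(2) by (metis mult.assoc mult_1)
qed

text \<open>Write \<open>2 u = (u + v) + (u - v)\<close> and apply the recurrence to the first summand.\<close>

lemma legendre_mult_left:
  "Const 2 * (u * legendre k u v) =
     Const (of_nat (k + 1) / of_nat (2 * k + 1)) * legendre (k + 1) u v +
     (case k of 0 \<Rightarrow> 0
      | Suc j \<Rightarrow> Const (of_nat k / of_nat (2 * k + 1)) * ((u - v) ^ 2 * legendre j u v)) +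
     (u - v) * legendre k u v"
proof (cases k)
  case 0
  have "Const 2 = 2" using Const_of_nat[of 2] by simp
  then show ?thesis using 0 by (simp add: legendre_1[unfolded One_nat_def])
next
  case (Suc j)
  define c where "c = (of_nat (2 * k + 1) :: complex)"
  have nz: "c \<noteq> 0" unfolding c_def by (simp only: of_nat_eq_0_iff)
  have c: "Const c * Const (a / c) = Const a" for a
    using nz by (simp flip: Const_mult)
  have "Const (of_nat (k + 1)) * legendre (k + 1) u v +
      Const (of_nat k) * ((u - v) ^ 2 * legendre j u v) = Const c * ((u + v) * legendre k u v)"
  proof -
    have eqs: "k + 1 = j + 2" "2 * k + 1 = 2 * j + 3" "k = j + 1" using Suc by simp_all
    show ?thesis
      unfolding c_def Const_of_nat eqs(1,2) unfolding eqs(3) by (rule legendre_recurrence)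
  qed
  then have "Const c * (Const (of_nat (k + 1) / c) * legendre (k + 1) u v +
      Const (of_nat k / c) * ((u - v) ^ 2 * legendre j u v)) = Const c * ((u + v) * legendre k u v)"
    by (simp only: distrib_left mult.assoc [symmetric] c)
  then have "Const (of_nat (k + 1) / c) * legendre (k + 1) u v +
      Const (of_nat k / c) * ((u - v) ^ 2 * legendre j u v) = (u + v) * legendre k u v"
    by (rule Const_cancel[OF nz])
  moreover have "Const 2 = 2" using Const_of_nat[of 2] by simp
  ultimately show ?thesis
    unfolding c_def [symmetric] using Suc by (simp add: algebra_simps)
qed

lemma power_eq_sum_legendre:
  "u ^ n = (\<Sum>k\<le>n. Const (legendre_coeff n k) * ((u - v) ^ (n - k) * legendre k u v))"
proof (induction n)
  case 0
  then show ?case by (simp add: legendre_coeff_def)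
next
  case (Suc n)
  let ?h = "legendre_coeff n" and ?L = "\<lambda>k. legendre k u v" and ?w = "u - v"
  let ?W = "\<lambda>k. ?w ^ (Suc n - k) * ?L k"
  let ?up = "\<lambda>k. case k of 0 \<Rightarrow> 0 | Suc j \<Rightarrow> of_nat k / of_nat (2 * j + 1) * ?h j"
  let ?down = "\<lambda>k. of_nat (k + 1) / of_nat (2 * k + 3) * ?h (Suc k)"
  have beyond: "?h k = 0" if "n < k" for k using that by (simp add: legendre_coeff_def)
  \<comment> \<open>The contributions to \<open>2 u\<^bsup>n+1\<^esup>\<close> that raise, lower and keep the index of the Legendre polynomial.\<close>
  define S1 where "S1 = (\<Sum>k\<le>n. Const (?h k) * (?w ^ (n - k) *
      (Const (of_nat (k + 1) / of_nat (2 * k + 1)) * ?L (k + 1))))"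
  define S2 where "S2 = (\<Sum>k\<le>n. Const (?h k) * (?w ^ (n - k) *
      (case k of 0 \<Rightarrow> 0 | Suc j \<Rightarrow> Const (of_nat k / of_nat (2 * k + 1)) * (?w ^ 2 * ?L j))))"
  define S3 where "S3 = (\<Sum>k\<le>n. Const (?h k) * (?w ^ (n - k) * (?w * ?L k)))"
  have "Const 2 * u ^ Suc n = (\<Sum>k\<le>n. Const (?h k) * (?w ^ (n - k) * (Const 2 * (u * ?L k))))"
    by (subst power_Suc, subst Suc)
      (simp only: sum_distrib_left mult.assoc mult.left_commute mult.commute)
  also have "\<dots> = S1 + S2 + S3"
    unfolding legendre_mult_left S1_def S2_def S3_def
    by (simp only: distrib_left sum.distrib)
  also have "S1 = (\<Sum>k\<le>Suc n. Const (?up k) * ?W k)"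
    unfolding S1_def sum.atMost_Suc_shift
    by (simp add: Const_mult mult_ac del: times_divide_eq_left times_divide_eq_right)
  also have "S2 = (\<Sum>k\<le>Suc n. Const (?down k) * ?W k)"
  proof -
    have "S2 = (\<Sum>k\<le>Suc n. Const (?h k) * (?w ^ (n - k) *
        (case k of 0 \<Rightarrow> 0 | Suc j \<Rightarrow> Const (of_nat k / of_nat (2 * k + 1)) * (?w ^ 2 * ?L j))))"
      unfolding S2_def by (simp add: beyond)
    also have "\<dots> = (\<Sum>k\<le>n. Const (?h (Suc k)) * (?w ^ (n - Suc k) *
        (Const (of_nat (Suc k) / of_nat (2 * Suc k + 1)) * (?w ^ 2 * ?L k))))"
      unfolding sum.atMost_Suc_shift by (simp only: nat.case) simp
    also have "\<dots> = (\<Sum>k\<le>n. Const (?down k) * ?W k)"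
    proof (rule sum.cong[OF refl])
      fix k assume "k \<in> {..n}"
      show "Const (?h (Suc k)) * (?w ^ (n - Suc k) *
          (Const (of_nat (Suc k) / of_nat (2 * Suc k + 1)) * (?w ^ 2 * ?L k))) =
          Const (?down k) * ?W k"
      proof (cases "k = n")
        case False
        then have "Suc n - k = (n - Suc k) + 2" using \<open>k \<in> {..n}\<close> by simp
        moreover have "2 * Suc k + 1 = 2 * k + 3" "Suc k = k + 1" by simp_all
        ultimately show ?thesis by (simp only: Const_mult power_add ac_simps)
      qed (simp add: beyond)
    qed
    finally show ?thesis by (simp add: beyond)
  qed
  also have "S3 = (\<Sum>k\<le>Suc n. Const (?h k) * ?W k)"
    unfolding S3_def by (simp add: beyond Suc_diff_le ac_simps)
  also have "(\<Sum>k\<le>Suc n. Const (?up k) * ?W k) + (\<Sum>k\<le>Suc n. Const (?down k) * ?W k) +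
      (\<Sum>k\<le>Suc n. Const (?h k) * ?W k) =
      (\<Sum>k\<le>Suc n. Const (?up k + ?down k + ?h k) * ?W k)"
    by (simp only: Const_add distrib_right sum.distrib)
  also have "\<dots> = Const 2 * (\<Sum>k\<le>Suc n. Const (legendre_coeff (Suc n) k) * ?W k)"
    by (simp only: legendre_coeff_Suc [symmetric] Const_mult sum_distrib_left mult.assoc)
  finally show ?case by (rule Const_cancel[rotated]) simp
qed

text \<open>Exchanging \<open>u\<close> and \<open>v\<close> fixes every Legendre polynomial and changes the sign of \<open>u - v\<close>, so in the
  difference the even powers of \<open>u - v\<close> cancel and the odd ones double.\<close>

lemma power_diff_eq_sum_legendre:
  assumes "n \<ge> 1"
  shows "u ^ n - v ^ n = (\<Sum>r=0..(n - 1) div 2. Const (2 * legendre_coeff n (n - (2 * r + 1))) *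
    ((u - v) ^ (2 * r + 1) * legendre (n - (2 * r + 1)) u v))"
proof -
  let ?g = "\<lambda>j. Const (legendre_coeff n (n - j)) *
    (((u - v) ^ j - (v - u) ^ j) * legendre (n - j) u v)"
  have two: "Const 2 = 2" using Const_of_nat[of 2] by simp
  have sgn: "(v - u) ^ j = (-1) ^ j * (u - v) ^ j" for j
    by (metis minus_diff_eq power_minus)
  have "u ^ n - v ^ n = (\<Sum>k\<le>n. ?g (n - k))"
    unfolding power_eq_sum_legendre[of u n v] power_eq_sum_legendre[of v n u]
      legendre_swap[of _ v u] sum_subtractf [symmetric]
    by (rule sum.cong) (simp_all add: algebra_simps)
  also have "\<dots> = (\<Sum>j\<le>n. ?g j)"
    using sum.nat_diff_reindex[of ?g "Suc n"] by (simp add: lessThan_Suc_atMost)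
  also have "\<dots> = (\<Sum>j\<in>(\<lambda>r. 2 * r + 1) ` {0..(n - 1) div 2}. ?g j)"
  proof (rule sum.mono_neutral_right)
    show "\<forall>j\<in>{..n} - (\<lambda>r. 2 * r + 1) ` {0..(n - 1) div 2}. ?g j = 0"
    proof
      fix j assume j: "j \<in> {..n} - (\<lambda>r. 2 * r + 1) ` {0..(n - 1) div 2}"
      have "even j"
      proof (rule ccontr)
        assume "odd j"
        then obtain m where m: "j = 2 * m + 1" by (rule oddE)
        then have "m \<in> {0..(n - 1) div 2}" using j by auto
        then show False using j m by blast
      qed
      then show "?g j = 0" by (simp add: sgn)
    qed
  qed (use assms in auto)
  also have "\<dots> = (\<Sum>r=0..(n - 1) div 2. ?g (2 * r + 1))"
    by (subst sum.reindex) (auto simp: inj_on_def)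
  also have "\<dots> = (\<Sum>r=0..(n - 1) div 2. Const (2 * legendre_coeff n (n - (2 * r + 1))) *
      ((u - v) ^ (2 * r + 1) * legendre (n - (2 * r + 1)) u v))"
  proof (rule sum.cong[OF refl])
    fix r
    have "(u - v) ^ (2 * r + 1) - (v - u) ^ (2 * r + 1) = 2 * (u - v) ^ (2 * r + 1)"
      unfolding sgn by simp
    then show "?g (2 * r + 1) = Const (2 * legendre_coeff n (n - (2 * r + 1))) *
      ((u - v) ^ (2 * r + 1) * legendre (n - (2 * r + 1)) u v)"
      by (simp only: Const_mult two mult.assoc mult.left_commute)
  qed
  finally show ?thesis .
qed

section \<open>Reduction to powers of linear forms\<close>

text \<open>The coefficient of \<open>x\<^sub>0\<close> is normalized to 1: the powers of these forms already span.\<close>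

definition xlin :: "complex \<Rightarrow> cpoly" where "xlin s = Const s * x1 + x0"

definition ylin :: "complex \<Rightarrow> cpoly" where "ylin s = Const s * y1 + y0"

lemma coeffs_zero_if_vanishing:
  assumes "\<And>s. (\<Sum>i\<le>n. Const (s ^ i) * f i) = 0" and "i \<le> n"
  shows "f i = 0"
proof (rule poly_mapping_eqI)
  fix m
  have "(\<Sum>i\<le>n. Poly_Mapping.lookup (f i) m * s ^ i) = 0" for s
    using arg_cong[OF assms(1)[of s], of "\<lambda>p. Poly_Mapping.lookup p m"]
    by (simp add: lookup_sum lookup_Const_mult) (simp add: mult.commute)
  then show "Poly_Mapping.lookup (f i) m = Poly_Mapping.lookup 0 m"
    using polyfun_eq_0[of "\<lambda>i. Poly_Mapping.lookup (f i) m" n] assms(2) by simp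
qed

text \<open>The binomial expansion of \<open>f((x\<^sub>0 + s x\<^sub>1)\<^sup>d)\<close> is a polynomial in \<open>s\<close> whose coefficients are nonzero
  multiples of the values of \<open>f\<close> at the monomials. If it vanishes for all \<open>s\<close>, so do its coefficients.\<close>

lemma clinear_eq_0_if_powers:
  assumes f: "clinear f" and powers: "\<And>s. f (xlin s ^ d) = 0" and A: "A \<in> binary_forms d"
  shows "f A = 0"
proof -
  have monomials: "f (x0 ^ i * x1 ^ (d - i)) = 0" if "i \<le> d" for i
  proof -
    let ?g = "\<lambda>k. Const (of_nat (d choose k)) * f (x1 ^ k * x0 ^ (d - k))"
    have "f (xlin s ^ d) = (\<Sum>k\<le>d. Const (s ^ k) * ?g k)" for s
    proof -
      have "xlin s ^ d =
          (\<Sum>k\<le>d. Const (s ^ k) * (Const (of_nat (d choose k)) * (x1 ^ k * x0 ^ (d - k))))"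
        unfolding xlin_def binomial_ring
        by (simp add: power_mult_distrib Const_power Const_of_nat ac_simps)
      then show ?thesis by (simp only: module_hom.sum[OF f] clinear_scale[OF f])
    qed
    then have "?g (d - i) = 0"
      using powers by (intro coeffs_zero_if_vanishing[where n = d and f = ?g]) auto
    then have "Const (of_nat (d choose (d - i))) * f (x0 ^ i * x1 ^ (d - i)) =
        Const (of_nat (d choose (d - i))) * 0"
      using that by (simp add: mult.commute)
    then show ?thesis by (rule Const_cancel[rotated]) simp
  qed
  obtain a where
    "A = (\<Sum>m\<in>Poly_Mapping.keys A. Const (Poly_Mapping.lookup A m) * (x0 ^ a m * x1 ^ (d - a m)))"
    and a: "\<And>m. m \<in> Poly_Mapping.keys A \<Longrightarrow> a m \<le> d"
    by (rule binary_form_expand[OF A]) (rule that)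
  then have "f A = f (\<Sum>m\<in>Poly_Mapping.keys A.
      Const (Poly_Mapping.lookup A m) * (x0 ^ a m * x1 ^ (d - a m)))"
    by simp
  also have "\<dots> = 0"
    using monomials a by (simp add: module_hom.sum[OF f] clinear_scale[OF f])
  finally show ?thesis .
qed

section \<open>The operations on powers of linear forms\<close>

lemma pdiff_Var: "pdiff v (Var w) = (if v = w then 1 else 0)"
  by (simp add: Var_def pdiff_single lookup_single when_def)

lemma pdiff_Const: "pdiff v (Const c) = 0"
  by (rule derivation_Const[OF derivation_pdiff])

lemma pdiff_Const_mult: "pdiff v (Const c * p) = Const c * pdiff v p"
  by (rule clinear_scale[OF clinear_pdiff])

lemma pdiff_xlin: "pdiff 0 (xlin s) = 1" "pdiff 1 (xlin s) = Const s"
  by (simp_all add: xlin_def clinear_plus[OF clinear_pdiff] pdiff_Const_mult pdiff_Var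
      del: One_nat_def)

lemma pdiff_ylin: "v < 2 \<Longrightarrow> pdiff v (ylin s) = 0"
  by (simp add: ylin_def clinear_plus[OF clinear_pdiff] pdiff_Const_mult pdiff_Var)

lemma funpow_pdiff_xlin_power:
  assumes "i + j \<le> d"
  shows "(pdiff 0 ^^ j) ((pdiff 1 ^^ i) (xlin s ^ d)) =
    Const (fact d / fact (d - (i + j)) * s ^ i) * xlin s ^ (d - (i + j))"
proof -
  have "(pdiff 1 ^^ i) (xlin s ^ d) = Const (fact d / fact (d - i) * s ^ i) * xlin s ^ (d - i)"
    using derivation_funpow_power[OF derivation_pdiff, of 1 "xlin s" i d] assms
    by (simp only: pdiff_xlin pdiff_Const Const_mult Const_power ac_simps)
  moreover have "(pdiff 0 ^^ j) (xlin s ^ (d - i)) =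
      Const (fact (d - i) / fact (d - (i + j))) * xlin s ^ (d - (i + j))"
    using derivation_funpow_power[OF derivation_pdiff, of 0 "xlin s" j "d - i"] assms
      pdiff_Const[of 0 1]
    by (simp add: pdiff_xlin)
  ultimately show ?thesis
    by (simp add: clinear_scale[OF clinear_funpow[OF clinear_pdiff]] mult.assoc [symmetric]
        Const_mult [symmetric])
qed

text \<open>All the derivatives are multiples of the same power, and the alternating sum of the factors
  \<open>s\<^sup>i t\<^bsup>r-i\<^esup>\<close> is the binomial expansion of \<open>(t - s)\<^sup>r\<close>.\<close>

lemma transvectant_xlin_powers:
  assumes "r \<le> d"
  shows "transvectant d d r (xlin s ^ d) (xlin t ^ d) =
    Const ((t - s) ^ r) * (xlin s ^ (d - r) * xlin t ^ (d - r))"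
proof -
  let ?c = "fact d / fact (d - r) :: complex"
  have terms: "(pdiff 0 ^^ (r - i)) ((pdiff 1 ^^ i) (xlin a ^ d)) = Const (?c * a ^ i) * xlin a ^ (d - r)"
    if "i \<le> r" for a i
    using funpow_pdiff_xlin_power[of i "r - i" d a] that assms by (simp del: One_nat_def)
  have "transvectant d d r (xlin s ^ d) (xlin t ^ d) =
      Const (fact (d - r) * fact (d - r) / (fact d * fact d)) *
      (\<Sum>i=0..r. Const ((-1) ^ i * of_nat (r choose i)) *
        (Const (?c * s ^ i) * xlin s ^ (d - r)) * (Const (?c * t ^ (r - i)) * xlin t ^ (d - r)))"
  proof -
    have "(\<Sum>i=0..r. Const ((-1) ^ i * of_nat (r choose i)) *
        (pdiff 0 ^^ (r - i)) ((pdiff 1 ^^ i) (xlin s ^ d)) *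
        (pdiff 0 ^^ i) ((pdiff 1 ^^ (r - i)) (xlin t ^ d))) =
      (\<Sum>i=0..r. Const ((-1) ^ i * of_nat (r choose i)) *
        (Const (?c * s ^ i) * xlin s ^ (d - r)) * (Const (?c * t ^ (r - i)) * xlin t ^ (d - r)))"
    proof (rule sum.cong[OF refl])
      fix i assume "i \<in> {0..r}"
      then show "Const ((-1) ^ i * of_nat (r choose i)) *
          (pdiff 0 ^^ (r - i)) ((pdiff 1 ^^ i) (xlin s ^ d)) *
          (pdiff 0 ^^ i) ((pdiff 1 ^^ (r - i)) (xlin t ^ d)) =
        Const ((-1) ^ i * of_nat (r choose i)) *
          (Const (?c * s ^ i) * xlin s ^ (d - r)) * (Const (?c * t ^ (r - i)) * xlin t ^ (d - r))"
        using terms[of i s] terms[of "r - i" t] by (simp del: One_nat_def)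
    qed
    then show ?thesis using assms by (simp only: transvectant_def min.idem if_True)
  qed
  also have "\<dots> = (\<Sum>i\<le>r. Const (of_nat (r choose i) * (- s) ^ i * t ^ (r - i)) *
      (xlin s ^ (d - r) * xlin t ^ (d - r)))"
    unfolding sum_distrib_left atMost_atLeast0
  proof (rule sum.cong[OF refl])
    fix i
    have "Const (fact (d - r) * fact (d - r) / (fact d * fact d)) *
        (Const ((-1) ^ i * of_nat (r choose i)) * (Const (?c * s ^ i) * xlin s ^ (d - r)) *
          (Const (?c * t ^ (r - i)) * xlin t ^ (d - r))) =
        Const (fact (d - r) * fact (d - r) / (fact d * fact d) *
          ((-1) ^ i * of_nat (r choose i)) * (?c * s ^ i) * (?c * t ^ (r - i))) *
        (xlin s ^ (d - r) * xlin t ^ (d - r))"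
      by (simp only: Const_mult ac_simps)
    also have "fact (d - r) * fact (d - r) / (fact d * fact d) *
        ((-1) ^ i * of_nat (r choose i)) * (?c * s ^ i) * (?c * t ^ (r - i)) =
        of_nat (r choose i) * (- s) ^ i * t ^ (r - i)"
      by (simp add: power_minus[of s])
    finally show "Const (fact (d - r) * fact (d - r) / (fact d * fact d)) *
        (Const ((-1) ^ i * of_nat (r choose i)) * (Const (?c * s ^ i) * xlin s ^ (d - r)) *
          (Const (?c * t ^ (r - i)) * xlin t ^ (d - r))) =
        Const (of_nat (r choose i) * (- s) ^ i * t ^ (r - i)) *
        (xlin s ^ (d - r) * xlin t ^ (d - r))" .
  qed
  also have "\<dots> = Const ((- s + t) ^ r) * (xlin s ^ (d - r) * xlin t ^ (d - r))"
    by (simp only: binomial_ring Const_sum sum_distrib_right)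
  finally show ?thesis by simp
qed

text \<open>The polarization operator is a derivation that replaces \<open>x\<close> by \<open>y\<close> in linear forms and kills what
  results. In the Leibniz expansion of its \<open>k\<close>-th power each term carries
  \<open>(k choose i) * (k! / (k - i)!) * (k! / i!) = k! * (k choose i)\<^sup>2\<close>: this is where the squares of
  binomial coefficients, and with them the Legendre polynomials, come from.\<close>

lemma polarization_xlin_powers:
  "polarization (2 * k) (xlin s ^ k * xlin t ^ k) =
   Const (1 / of_nat ((2 * k) choose k)) * legendre k (xlin s * ylin t) (xlin t * ylin s)"
proof -
  define D where "D = (\<lambda>p. y0 * pdiff 0 p + y1 * pdiff 1 p)"
  have D: "derivation D"
    unfolding D_def by (intro derivation_combination derivation_pdiff)
  have Dx: "D (xlin a) = ylin a" and Dy: "D (ylin a) = 0" for a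
    by (simp add: D_def pdiff_xlin del: One_nat_def, simp add: ylin_def ac_simps)
      (simp add: D_def pdiff_ylin)
  have Dn: "(D ^^ i) (xlin a ^ k) = Const (fact k / fact (k - i)) * (xlin a ^ (k - i) * ylin a ^ i)"
    if "i \<le> k" for i a
    using derivation_funpow_power[OF D, of "xlin a" i k] that by (simp add: Dx Dy)
  have "(D ^^ k) (xlin s ^ k * xlin t ^ k) =
      (\<Sum>i\<le>k. of_nat (k choose i) * ((D ^^ i) (xlin s ^ k) * (D ^^ (k - i)) (xlin t ^ k)))"
    by (rule derivation_funpow_mult[OF D])
  also have "\<dots> = (\<Sum>i\<le>k. Const (fact k) * (of_int (int (k choose i) ^ 2) *
      ((xlin t * ylin s) ^ i * (xlin s * ylin t) ^ (k - i))))"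
  proof (rule sum.cong[OF refl])
    fix i assume "i \<in> {..k}"
    then have i: "i \<le> k" by simp
    have "of_nat (k choose i) * ((D ^^ i) (xlin s ^ k) * (D ^^ (k - i)) (xlin t ^ k)) =
        Const (of_nat (k choose i) * (fact k / fact (k - i)) * (fact k / fact i)) *
        ((xlin t * ylin s) ^ i * (xlin s * ylin t) ^ (k - i))"
      unfolding Dn[OF i] Dn[OF diff_le_self] diff_diff_cancel[OF i] Const_mult Const_of_nat
        power_mult_distrib
      by (simp only: mult.assoc mult.left_commute mult.commute)
    also have "of_nat (k choose i) * (fact k / fact (k - i)) * (fact k / fact i) =
        (fact k * of_nat ((k choose i) ^ 2) :: complex)"
      using i by (simp add: binomial_fact power2_eq_square mult_ac)
    finally show "of_nat (k choose i) * ((D ^^ i) (xlin s ^ k) * (D ^^ (k - i)) (xlin t ^ k)) =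
        Const (fact k) * (of_int (int (k choose i) ^ 2) *
        ((xlin t * ylin s) ^ i * (xlin s * ylin t) ^ (k - i)))"
      by (simp only: Const_mult Const_of_nat mult.assoc) simp
  qed
  also have "\<dots> = Const (fact k) * legendre k (xlin t * ylin s) (xlin s * ylin t)"
    by (simp only: legendre_def bihom_def sum_distrib_left)
  finally have "(D ^^ k) (xlin s ^ k * xlin t ^ k) =
      Const (fact k) * legendre k (xlin s * ylin t) (xlin t * ylin s)"
    by (simp only: legendre_swap)
  moreover have "fact (2 * k - k) / fact (2 * k) * fact k = (1 / of_nat ((2 * k) choose k) :: complex)"
    by (simp add: binomial_fact)
  ultimately show ?thesis
    unfolding polarization_def Let_def D_def [symmetric]
    by (simp add: mult.assoc [symmetric] Const_mult [symmetric])
qed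

section \<open>The expansion of the Bezoutiant\<close>

lemma in_y_xlin_power: "in_y (xlin s ^ d) = ylin s ^ d"
  by (simp add: in_y_def subst_power xlin_def ylin_def clinear_plus[OF clinear_subst] subst_mult
      subst_Const subst_Var)

lemma xlin_ylin_diff: "xlin s * ylin t - xlin t * ylin s = Const (t - s) * omega"
  by (simp add: xlin_def ylin_def omega_def Const_diff algebra_simps)

lemma clinear_in_y: "clinear in_y"
  using clinear_subst unfolding in_y_def .

lemma clinear_transvectant_left: "clinear (\<lambda>E. transvectant e f r E F)"
  and clinear_transvectant_right: "clinear (\<lambda>F. transvectant e f r E F)"
proof -
  show "clinear (\<lambda>E. transvectant e f r E F)"
    unfolding transvectant_def
    by (cases "r \<le> min e f", simp_all only: if_True if_False)
      (intro clinear_intros clinear_compose[OF clinear_funpow] clinear_funpow clinear_pdiff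
        cpoly.module_hom_zero)+
  show "clinear (\<lambda>F. transvectant e f r E F)"
    unfolding transvectant_def
    by (cases "r \<le> min e f", simp_all only: if_True if_False)
      (intro clinear_intros clinear_compose[OF clinear_funpow] clinear_funpow clinear_pdiff
        cpoly.module_hom_zero)+
qed

lemma clinear_polarization: "clinear (polarization e)"
  unfolding polarization_def Let_def
  by (intro clinear_mult_left clinear_funpow derivation_linear derivation_combination
      derivation_pdiff)

text \<open>The right-hand side of the expansion as an operation on arbitrary pairs of forms, so that its
  bilinearity can be stated.\<close>

definition bezoutiant_series :: "nat \<Rightarrow> cpoly \<Rightarrow> cpoly \<Rightarrow> cpoly" where
  "bezoutiant_series d A B = (\<Sum>r=0..(d - 1) div 2.
     Const (2 * of_nat (d choose (2 * r + 1)) ^ 2 / of_nat ((2 * d - 2 * r) choose (2 * r + 1))) *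
     omega ^ (2 * r) * polarization (2 * d - 2 * (2 * r + 1)) (transvectant d d (2 * r + 1) A B))"

text \<open>Multiplication by \<open>\<omega>\<close> turns the even powers of \<open>\<omega>\<close> into odd ones, which absorb the odd powers of
  \<open>t - s\<close> from the transvectants and become powers of \<open>u - v\<close>.\<close>

lemma bezoutiant_series_xlin_powers:
  assumes "d \<ge> 1"
  shows "bezoutiant_series d (xlin s ^ d) (xlin t ^ d) * omega =
    xlin s ^ d * ylin t ^ d - xlin t ^ d * ylin s ^ d"
proof -
  let ?u = "xlin s * ylin t" and ?v = "xlin t * ylin s"
  have "bezoutiant_series d (xlin s ^ d) (xlin t ^ d) * omega =
      (\<Sum>r=0..(d - 1) div 2. Const (2 * legendre_coeff d (d - (2 * r + 1))) *
        ((?u - ?v) ^ (2 * r + 1) * legendre (d - (2 * r + 1)) ?u ?v))"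
    unfolding bezoutiant_series_def sum_distrib_right
  proof (rule sum.cong[OF refl])
    fix r assume "r \<in> {0..(d - 1) div 2}"
    then have r: "2 * r + 1 \<le> d" using assms by simp
    define k where "k = d - (2 * r + 1)"
    have k: "2 * d - 2 * (2 * r + 1) = 2 * k" "k \<le> d" "d + k + 1 = 2 * d - 2 * r" "d - k = 2 * r + 1"
      using r by (simp_all add: k_def)
    define c :: complex where
      "c = 2 * of_nat (d choose (2 * r + 1)) ^ 2 / of_nat ((2 * d - 2 * r) choose (2 * r + 1))"
    have "d choose (2 * r + 1) = d choose k"
      using binomial_symmetric[OF k(2)] k(4) by simp
    then have c: "c * (1 / of_nat ((2 * k) choose k)) = 2 * legendre_coeff d k"
      unfolding legendre_coeff_eq_binomials[OF k(2)] k(3,4) c_def by simp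
    have summand: "polarization (2 * k) (transvectant d d (2 * r + 1) (xlin s ^ d) (xlin t ^ d)) =
        Const ((t - s) ^ (2 * r + 1)) * (Const (1 / of_nat ((2 * k) choose k)) * legendre k ?u ?v)"
      unfolding transvectant_xlin_powers[OF r] k_def [symmetric]
        clinear_scale[OF clinear_polarization] polarization_xlin_powers ..
    have "Const c * omega ^ (2 * r) *
        polarization (2 * k) (transvectant d d (2 * r + 1) (xlin s ^ d) (xlin t ^ d)) * omega =
        Const (c * (1 / of_nat ((2 * k) choose k))) *
        ((Const (t - s) * omega) ^ (2 * r + 1) * legendre k ?u ?v)"
      unfolding summand
      by (simp only: Const_mult Const_power power_mult_distrib power_add power_one_right
          mult.assoc mult.left_commute mult.commute)
    then show "Const (2 * of_nat (d choose (2 * r + 1)) ^ 2 / of_nat ((2 * d - 2 * r) choose (2 * r + 1))) *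
        omega ^ (2 * r) * polarization (2 * d - 2 * (2 * r + 1))
          (transvectant d d (2 * r + 1) (xlin s ^ d) (xlin t ^ d)) * omega =
        Const (2 * legendre_coeff d (d - (2 * r + 1))) *
        ((?u - ?v) ^ (2 * r + 1) * legendre (d - (2 * r + 1)) ?u ?v)"
      unfolding c xlin_ylin_diff k(1) k_def [symmetric] c_def [symmetric] .
  qed
  also have "\<dots> = ?u ^ d - ?v ^ d"
    by (rule power_diff_eq_sum_legendre[OF assms, symmetric])
  finally show ?thesis by (simp only: power_mult_distrib)
qed

lemma clinear_bezoutiant_series_left: "clinear (\<lambda>A. bezoutiant_series d A B)"
  and clinear_bezoutiant_series_right: "clinear (\<lambda>B. bezoutiant_series d A B)"
  unfolding bezoutiant_series_def
  by (intro clinear_intros clinear_compose[OF clinear_polarization]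
      clinear_transvectant_left clinear_transvectant_right)+

theorem proposition2p4:
  fixes d :: nat and A B :: cpoly and T :: "nat \<Rightarrow> cpoly" and c :: "nat \<Rightarrow> complex"
  assumes "d \<ge> 1"
    and "A \<in> binary_forms d" and "B \<in> binary_forms d"
    and "lin_indep_pair A B"
    and "\<And>i. T i = transvectant d d i A B"
    and "\<And>r. r \<le> (d - 1) div 2 \<Longrightarrow>
           c r = 2 * of_nat (d choose (2 * r + 1)) ^ 2 / of_nat ((2 * d - 2 * r) choose (2 * r + 1))"
  shows "bezoutiant A B =
    (\<Sum>r=0..(d - 1) div 2.
       Const (c r) * omega ^ (2 * r) * polarization (2 * d - 2 * (2 * r + 1)) (T (2 * r + 1)))"
proof -
  \<comment> \<open>The defect of the claim, cleared of the denominator \<open>omega\<close>, is bilinear and can be tested on powers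
    in one argument at a time.\<close>
  define \<Psi> where "\<Psi> A B = bezoutiant_series d A B * omega - (A * in_y B - B * in_y A)" for A B
  have left: "clinear (\<lambda>A. \<Psi> A B)" and right: "clinear (\<lambda>B. \<Psi> A B)" for A B
    unfolding \<Psi>_def
    by (intro clinear_intros clinear_in_y clinear_bezoutiant_series_left
        clinear_bezoutiant_series_right)+
  have "\<Psi> (xlin s ^ d) (xlin t ^ d) = 0" for s t
    by (simp add: \<Psi>_def bezoutiant_series_xlin_powers[OF assms(1)] in_y_xlin_power)
  then have "\<Psi> A (xlin t ^ d) = 0" for t
    by (intro clinear_eq_0_if_powers[OF left _ assms(2)])
  then have "\<Psi> A B = 0"
    by (intro clinear_eq_0_if_powers[OF right _ assms(3)])
  then have "bezoutiant A B = bezoutiant_series d A B"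
    by (intro bezoutiant_eqI) (simp add: \<Psi>_def)
  also have "\<dots> = (\<Sum>r=0..(d - 1) div 2.
      Const (c r) * omega ^ (2 * r) * polarization (2 * d - 2 * (2 * r + 1)) (T (2 * r + 1)))"
    unfolding bezoutiant_series_def by (rule sum.cong) (simp_all add: assms(5,6))
  finally show ?thesis .
qed

end
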